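(* Let $\psi\colon\mathbb{R}\to\mathbb{R}$ be non-decreasing and such that $\lim_{n\to\infty}\psi^n(t)=-\infty$ for every $t\in(0,\infty)$, and let $F\colon(0,\infty)\to\mathbb{R}$ be a function that satisfies one of the following two conditions: (i) $\inf F>-\infty$; (ii) for every sequence $(\alpha_n)\subseteq(0,\infty)$ we have $\lim_{n\to\infty}F(\alpha_n)=-\infty$ if and only if $\lim_{n\to\infty}\alpha_n=0$. Suppose that $(X,d)$ is a nonempty complete $b$-metric space with constant $s\ge1$ and $T\colon X\to X$ is an operator such that for all $x,y\in X$ $$d(Tx,Ty)\ne0\ \text{ implies }\ F(d(Tx,Ty))\le\psi(F(d(x,y))).$$ Then $T$ is a Picard-operator.
   Context: A pair $(X,d)$ is a $b$-metric space with constant $s\ge1$ if $d\colon X\times X\to[0,\infty)$ satisfies, for all $x,y,z\in X$: (i) $d(x,y)=0$ if and only if $x=y$; (ii) $d(x,y)=d(y,x)$; (iii) $d(x,y)\le s[d(x,z)+d(z,y)]$. (The functional $d$ need not be continuous.) Convergence $x_n\to x^*$ means $d(x_n,x^* )\to0$; Cauchy sequences and completeness are defined with respect to $d$ as for metric spaces. An operator $T\colon X\to X$ on a complete $b$-metric space is a Picard-operator if $T$ has a unique fixed point $x^*$ and $T^nx\to x^*$ for all $x\in X$. $\psi^n$ denotes the $n$-fold composition of $\psi$ with itself. *)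

theory Defs
  imports Complex_Main "HOL-Library.FuncSet"
begin

text \<open>As in the library's \<open>Metric_space\<close>, the space is a carrier set \<open>X\<close> and
  \<open>d\<close> is a total function of which only the values on \<open>X\<close> matter.\<close>

locale b_metric_space =
  fixes X :: "'a set" and d :: "'a \<Rightarrow> 'a \<Rightarrow> real" and s :: real
  assumes const_ge_1: "s \<ge> 1"
    and nonneg: "\<And>x y. \<lbrakk>x \<in> X; y \<in> X\<rbrakk> \<Longrightarrow> 0 \<le> d x y"
    and zero_iff: "\<And>x y. \<lbrakk>x \<in> X; y \<in> X\<rbrakk> \<Longrightarrow> d x y = 0 \<longleftrightarrow> x = y"
    and commute: "\<And>x y. \<lbrakk>x \<in> X; y \<in> X\<rbrakk> \<Longrightarrow> d x y = d y x"
    and triangle: "\<And>x y z. \<lbrakk>x \<in> X; y \<in> X; z \<in> X\<rbrakk> \<Longrightarrow> d x y \<le> s * (d x z + d z y)"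

definition b_converges :: "('a \<Rightarrow> 'a \<Rightarrow> real) \<Rightarrow> (nat \<Rightarrow> 'a) \<Rightarrow> 'a \<Rightarrow> bool" where
  "b_converges d u l \<longleftrightarrow> (\<lambda>n. d (u n) l) \<longlonglongrightarrow> 0"

definition b_Cauchy :: "('a \<Rightarrow> 'a \<Rightarrow> real) \<Rightarrow> (nat \<Rightarrow> 'a) \<Rightarrow> bool" where
  "b_Cauchy d u \<longleftrightarrow> (\<forall>\<epsilon>>0. \<exists>N. \<forall>m\<ge>N. \<forall>n\<ge>N. d (u m) (u n) < \<epsilon>)"

definition b_complete :: "'a set \<Rightarrow> ('a \<Rightarrow> 'a \<Rightarrow> real) \<Rightarrow> bool" where
  "b_complete X d \<longleftrightarrow>
     (\<forall>u. range u \<subseteq> X \<longrightarrow> b_Cauchy d u \<longrightarrow> (\<exists>l\<in>X. b_converges d u l))"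

definition picard_operator :: "'a set \<Rightarrow> ('a \<Rightarrow> 'a \<Rightarrow> real) \<Rightarrow> ('a \<Rightarrow> 'a) \<Rightarrow> bool" where
  "picard_operator X d T \<longleftrightarrow> T \<in> X \<rightarrow> X \<and>
     (\<exists>p\<in>X. T p = p \<and> (\<forall>q\<in>X. T q = q \<longrightarrow> q = p) \<and>
        (\<forall>x\<in>X. b_converges d (\<lambda>n. (T ^^ n) x) p))"

end

theory Submission imports Defs begin

text \<open>
  Iterating the contraction condition gives
  \<open>F (d (T\<^sup>n x) (T\<^sup>n y)) \<le> \<psi>\<^sup>n (F (d x y))\<close> as long as
  \<open>T\<^sup>n x \<noteq> T\<^sup>n y\<close>, and the right-hand side tends to \<open>-\<infinity>\<close>. If \<open>F\<close> is bounded below, the orbits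
  of \<open>x\<close> and \<open>y\<close> must therefore meet, and with \<open>y = T x\<close> the meeting point is fixed.
  Otherwise \<open>F t\<close> is very negative exactly for small \<open>t\<close>, so that a single power \<open>T\<^sup>k\<close> shrinks
  every sufficiently small \<open>\<epsilon>\<close>-ball to within \<open>\<epsilon> / (2 s)\<close> of the image of its center. Far along an orbit
  the center \<open>x\<^sub>N\<close> is moved by less than \<open>\<epsilon> / (2 s)\<close>, so \<open>T\<^sup>k\<close> maps the ball into itself,
  which traps the whole tail of the orbit and makes it Cauchy.
\<close>

section \<open>Iterates, sequential limits and the comparison function \<psi>\<close>

lemma funpow_in_Pi:
  assumes "T \<in> X \<rightarrow> X" "x \<in> X"
  shows "(T ^^ n) x \<in> X"
  using assms by (induction n) auto

lemma filterlim_at_bot_mono: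
  fixes f g :: "'a \<Rightarrow> 'b::linorder"
  assumes "filterlim g at_bot \<F>" and "\<forall>\<^sub>F x in \<F>. f x \<le> g x"
  shows "filterlim f at_bot \<F>"
  unfolding filterlim_at_bot
proof
  fix Z
  have "\<forall>\<^sub>F x in \<F>. g x \<le> Z"
    using assms(1) by (simp add: filterlim_at_bot)
  with assms(2) show "\<forall>\<^sub>F x in \<F>. f x \<le> Z"
    by eventually_elim simp
qed

text \<open>Otherwise arguments \<open>\<alpha> n \<ge> \<epsilon>\<close> with
  \<open>F (\<alpha> n) < - n\<close> would exist, a sequence that violates the sequential
  condition. This and the next lemma turn the two directions of condition (ii) into bounds that hold
  uniformly in t.\<close>

lemma small_argument_if_at_bot:
  fixes F :: "real \<Rightarrow> real"
  assumes "\<And>\<alpha> :: nat \<Rightarrow> real. \<lbrakk>\<And>n. \<alpha> n > 0; filterlim (\<lambda>n. F (\<alpha> n)) at_bot sequentially\<rbrakk>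
             \<Longrightarrow> \<alpha> \<longlonglongrightarrow> 0"
    and "\<epsilon> > 0"
  shows "\<exists>M. \<forall>t>0. F t < M \<longrightarrow> t < \<epsilon>"
proof (rule ccontr)
  assume "\<not> ?thesis"
  then have "\<forall>n::nat. \<exists>t>0. F t < - real n \<and> t \<ge> \<epsilon>"
    by (meson not_less)
  then obtain \<alpha> :: "nat \<Rightarrow> real"
    where \<alpha>: "\<And>n. \<alpha> n > 0" "\<And>n. F (\<alpha> n) < - real n" "\<And>n. \<alpha> n \<ge> \<epsilon>"
    by metis
  have "filterlim (\<lambda>n. - real n) at_bot sequentially"
    by (simp add: filterlim_uminus_at_bot filterlim_real_sequentially)
  then have "filterlim (\<lambda>n. F (\<alpha> n)) at_bot sequentially"
    by (rule filterlim_at_bot_mono) (intro always_eventually allI less_imp_le \<alpha>)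
  with assms(1) \<alpha>(1) have "\<alpha> \<longlonglongrightarrow> 0"
    by blast
  then have "\<epsilon> \<le> 0"
    using \<alpha>(3) by (intro LIMSEQ_le_const) auto
  with assms(2) show False
    by simp
qed

text \<open>A failure at every radius \<open>1 / (n + 1)\<close> yields a null sequence along which
  F stays at or above M.\<close>

lemma at_bot_if_small_argument:
  fixes F :: "real \<Rightarrow> real"
  assumes "\<And>\<alpha> :: nat \<Rightarrow> real. \<lbrakk>\<And>n. \<alpha> n > 0; \<alpha> \<longlonglongrightarrow> 0\<rbrakk>
             \<Longrightarrow> filterlim (\<lambda>n. F (\<alpha> n)) at_bot sequentially"
  shows "\<exists>\<delta>>0. \<forall>t>0. t < \<delta> \<longrightarrow> F t < M"
proof (rule ccontr)
  assume *: "\<not> ?thesis"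
  have "\<exists>t>0. t < inverse (real (Suc n)) \<and> F t \<ge> M" for n
    using * by (metis inverse_positive_iff_positive not_less of_nat_0_less_iff zero_less_Suc)
  then obtain \<alpha> :: "nat \<Rightarrow> real"
    where \<alpha>: "\<And>n. \<alpha> n > 0" "\<And>n. \<alpha> n < inverse (real (Suc n))" "\<And>n. F (\<alpha> n) \<ge> M"
    by metis
  have "\<alpha> \<longlonglongrightarrow> 0"
    by (rule real_tendsto_sandwich[OF _ _ tendsto_const LIMSEQ_inverse_real_of_nat])
      (intro always_eventually allI less_imp_le \<alpha>)+
  with assms \<alpha>(1) have "filterlim (\<lambda>n. F (\<alpha> n)) at_bot sequentially"
    by blast
  then have "\<forall>\<^sub>F n in sequentially. F (\<alpha> n) < M"
    by (simp add: filterlim_at_bot_dense)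
  with \<alpha>(3) show False
    by (auto simp: not_less[symmetric] eventually_sequentially)
qed

text \<open>\<psi> is applied to values of F, which may be nonpositive, while the theorem controls
  iterates only from positive t. By monotonicity the iterates from \<open>max t 1\<close> dominate
  those from t.\<close>

lemma funpow_at_bot_everywhere:
  fixes \<psi> :: "real \<Rightarrow> real"
  assumes "mono \<psi>"
    and "\<And>t. t > 0 \<Longrightarrow> filterlim (\<lambda>n. (\<psi> ^^ n) t) at_bot sequentially"
  shows "filterlim (\<lambda>n. (\<psi> ^^ n) t) at_bot sequentially"
proof (rule filterlim_at_bot_mono)
  show "filterlim (\<lambda>n. (\<psi> ^^ n) (max t 1)) at_bot sequentially"
    by (rule assms(2)) simp
  show "\<forall>\<^sub>F n in sequentially. (\<psi> ^^ n) t \<le> (\<psi> ^^ n) (max t 1)"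
    using funpow_mono[OF assms(1)] by (auto intro: always_eventually)
qed

text \<open>If \<open>t \<le> \<psi> t\<close>, monotonicity keeps every iterate above t, so the
  iterates cannot tend to -\<infinity>.\<close>

lemma less_self_if_funpow_at_bot:
  fixes \<psi> :: "real \<Rightarrow> real"
  assumes "mono \<psi>" and "filterlim (\<lambda>n. (\<psi> ^^ n) t) at_bot sequentially"
  shows "\<psi> t < t"
proof (rule ccontr)
  assume "\<not> \<psi> t < t"
  then have "t \<le> \<psi> t"
    by simp
  have "t \<le> (\<psi> ^^ n) t" for n
  proof (induction n)
    case (Suc n)
    with monoD[OF assms(1) this] \<open>t \<le> \<psi> t\<close> show ?case
      by simp
  qed simp
  moreover have "\<forall>\<^sub>F n in sequentially. (\<psi> ^^ n) t < t"
    using assms(2) by (simp add: filterlim_at_bot_dense)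
  ultimately show False
    by (auto simp: not_less[symmetric] eventually_sequentially)
qed

section \<open>F-contractions: iterated estimate and uniqueness of fixed points\<close>

locale F_contraction = b_metric_space X d s
  for X :: "'a set" and d s +
  fixes \<psi> F :: "real \<Rightarrow> real" and T :: "'a \<Rightarrow> 'a"
  assumes mono_\<psi>: "mono \<psi>"
    and funpow_\<psi>: "filterlim (\<lambda>n. (\<psi> ^^ n) t) at_bot sequentially"
    and self_map: "T \<in> X \<rightarrow> X"
    and contraction:
      "\<lbrakk>x \<in> X; y \<in> X; d (T x) (T y) \<noteq> 0\<rbrakk> \<Longrightarrow> F (d (T x) (T y)) \<le> \<psi> (F (d x y))"
begin

lemmas T_in = funcset_mem[OF self_map]
lemmas orbit_in = funpow_in_Pi[OF self_map]

lemma dist_pos: "\<lbrakk>x \<in> X; y \<in> X; x \<noteq> y\<rbrakk> \<Longrightarrow> 0 < d x y"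
  using nonneg zero_iff by (metis less_eq_real_def)

lemma dist_self: "x \<in> X \<Longrightarrow> d x x = 0"
  using zero_iff by blast

text \<open>Orbits that have met stay together. Hence distinctness at the last step gives
  distinctness at all earlier ones, where the contraction condition is needed.\<close>

lemma contraction_iter:
  assumes "x \<in> X" "y \<in> X" "(T ^^ n) x \<noteq> (T ^^ n) y"
  shows "F (d ((T ^^ n) x) ((T ^^ n) y)) \<le> (\<psi> ^^ n) (F (d x y))"
  using assms(3)
proof (induction n)
  case (Suc n)
  let ?x = "(T ^^ n) x" and ?y = "(T ^^ n) y"
  have in_X: "?x \<in> X" "?y \<in> X"
    using assms orbit_in by auto
  have "?x \<noteq> ?y"
    using Suc.prems by auto
  have "F (d (T ?x) (T ?y)) \<le> \<psi> (F (d ?x ?y))"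
    using Suc.prems in_X T_in zero_iff by (intro contraction) auto
  also have "\<dots> \<le> \<psi> ((\<psi> ^^ n) (F (d x y)))"
    by (intro monoD[OF mono_\<psi>] Suc.IH \<open>?x \<noteq> ?y\<close>)
  finally show ?case
    by simp
qed simp

lemma fixed_point_unique:
  assumes "p \<in> X" "q \<in> X" "T p = p" "T q = q"
  shows "q = p"
proof (rule ccontr)
  assume "q \<noteq> p"
  then have "F (d q p) \<le> \<psi> (F (d q p))"
    using contraction[of q p] assms zero_iff by auto
  with less_self_if_funpow_at_bot[OF mono_\<psi> funpow_\<psi>] show False
    by (simp add: not_le[symmetric])
qed

section \<open>Case (i): F bounded below\<close>

lemma picard_if_bdd_below:
  assumes "bdd_below (F ` {0<..})" and "X \<noteq> {}"
  shows "picard_operator X d T"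
proof -
  obtain m where m: "\<And>t. t > 0 \<Longrightarrow> m \<le> F t"
    using assms(1) by (auto simp: bdd_below_def)
  have meet: "\<exists>n. (T ^^ n) x = (T ^^ n) y" if "x \<in> X" "y \<in> X" for x y
  proof -
    obtain n where n: "(\<psi> ^^ n) (F (d x y)) < m"
      using funpow_\<psi>[of "F (d x y)"]
      by (auto simp: filterlim_at_bot_dense eventually_sequentially)
    have "(T ^^ n) x = (T ^^ n) y"
    proof (rule ccontr)
      assume neq: "(T ^^ n) x \<noteq> (T ^^ n) y"
      then have "m \<le> F (d ((T ^^ n) x) ((T ^^ n) y))"
        by (intro m dist_pos orbit_in that)
      with contraction_iter[OF that neq] n show False
        by simp
    qed
    then show ?thesis ..
  qed
  obtain x0 where "x0 \<in> X"
    using assms(2) by blast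
  \<comment> \<open>The orbits of \<open>x0\<close> and \<open>T x0\<close> meet at the same index,
    and \<open>T ^^ n\<close> commutes with T, so the meeting point is fixed.\<close>
  obtain n where n: "(T ^^ n) x0 = (T ^^ n) (T x0)"
    using meet[of x0 "T x0"] T_in \<open>x0 \<in> X\<close> by blast
  define p where "p = (T ^^ n) x0"
  have p: "p \<in> X" "T p = p"
    unfolding p_def by (rule orbit_in[OF \<open>x0 \<in> X\<close>], metis n funpow_swap1)
  have p_iter: "(T ^^ n) p = p" for n
    by (induction n) (simp_all add: p)
  have "b_converges d (\<lambda>n. (T ^^ n) x) p" if "x \<in> X" for x
  proof -
    \<comment> \<open>Every orbit meets the constant orbit of p, and from then on it equals
      p.\<close>
    obtain k where k: "(T ^^ k) x = p"
      using meet[OF \<open>x \<in> X\<close> p(1)] p_iter by auto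
    have "d ((T ^^ n) x) p = 0" if "n \<ge> k" for n
    proof -
      have "(T ^^ n) x = (T ^^ (n - k)) ((T ^^ k) x)"
        using that by (simp flip: funpow_add[THEN fun_cong, unfolded comp_apply])
      then show ?thesis
        using k p_iter p(1) zero_iff by simp
    qed
    then show ?thesis
      unfolding b_converges_def
      by (intro tendsto_eventually) (auto simp: eventually_sequentially)
  qed
  with p fixed_point_unique self_map show ?thesis
    unfolding picard_operator_def by blast
qed

section \<open>Case (ii): F is very negative exactly at small distances\<close>

context
  assumes small_if_F: "\<epsilon> > 0 \<Longrightarrow> \<exists>M. \<forall>t>0. F t < M \<longrightarrow> t < \<epsilon>"
    and F_if_small: "\<exists>\<delta>>0. \<forall>t>0. t < \<delta> \<longrightarrow> F t < M"
begin

lemma dist_iter_tendsto_0: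
  assumes "x \<in> X" "y \<in> X"
  shows "(\<lambda>n. d ((T ^^ n) x) ((T ^^ n) y)) \<longlonglongrightarrow> 0"
proof (rule order_tendstoI)
  fix \<epsilon> :: real
  assume "0 < \<epsilon>"
  then obtain M where M: "\<And>t. \<lbrakk>t > 0; F t < M\<rbrakk> \<Longrightarrow> t < \<epsilon>"
    using small_if_F by blast
  have "\<forall>\<^sub>F n in sequentially. (\<psi> ^^ n) (F (d x y)) < M"
    using funpow_\<psi> by (simp add: filterlim_at_bot_dense)
  then show "\<forall>\<^sub>F n in sequentially. d ((T ^^ n) x) ((T ^^ n) y) < \<epsilon>"
  proof eventually_elim
    case (elim n)
    show ?case
    proof (cases "(T ^^ n) x = (T ^^ n) y")
      case True
      with \<open>0 < \<epsilon>\<close> show ?thesis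
        using dist_self orbit_in assms by simp
    next
      case False
      with M show ?thesis
        using contraction_iter[OF assms False] elim dist_pos orbit_in assms
        by (meson le_less_trans)
    qed
  qed
next
  fix a :: real
  assume "a < 0"
  then show "\<forall>\<^sub>F n in sequentially. a < d ((T ^^ n) x) ((T ^^ n) y)"
    using nonneg orbit_in assms by (intro always_eventually allI) (meson less_le_trans)
qed

text \<open>By \<open>\<psi> t < t\<close>, T lowers F of the distance between points with distinct
  images. A distance small enough for F to lie below M thus yields an image distance with the same
  property, which is then below \<epsilon>.\<close>

lemma continuity:
  assumes "\<epsilon> > 0"
  shows "\<exists>\<delta>>0. \<forall>x\<in>X. \<forall>y\<in>X. d x y < \<delta> \<longrightarrow> d (T x) (T y) < \<epsilon>"
proof -
  obtain M where M: "\<And>t. \<lbrakk>t > 0; F t < M\<rbrakk> \<Longrightarrow> t < \<epsilon>"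
    using small_if_F[OF assms] by blast
  obtain \<delta> where \<delta>: "\<delta> > 0" "\<And>t. \<lbrakk>t > 0; t < \<delta>\<rbrakk> \<Longrightarrow> F t < M"
    using F_if_small by blast
  have "d (T x) (T y) < \<epsilon>" if xy: "x \<in> X" "y \<in> X" "d x y < \<delta>" for x y
  proof (cases "T x = T y")
    case True
    then show ?thesis
      using assms xy T_in dist_self by simp
  next
    case False
    have "F (d (T x) (T y)) \<le> \<psi> (F (d x y))"
      using False xy T_in zero_iff by (intro contraction) auto
    also have "\<dots> < F (d x y)"
      by (rule less_self_if_funpow_at_bot[OF mono_\<psi> funpow_\<psi>])
    also have "F (d x y) < M"
      using False xy by (intro \<delta>(2) dist_pos) auto
    finally show ?thesis
      using False xy T_in by (intro M dist_pos) auto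
  qed
  with \<delta>(1) show ?thesis
    by blast
qed

text \<open>The order of quantifiers matters: \<delta> does not depend on \<epsilon>. It only
  ensures \<open>F (d x y) < 0\<close> for distinct x and y, so that the iterates of \<psi> from the
  single value 0 dominate those for all close pairs, and k depends on \<epsilon> alone.\<close>

lemma uniform_shrinking:
  "\<exists>\<delta>>0. \<forall>\<epsilon>>0. \<exists>k>0. \<forall>x\<in>X. \<forall>y\<in>X. d x y < \<delta> \<longrightarrow> d ((T ^^ k) x) ((T ^^ k) y) < \<epsilon>"
proof -
  obtain \<delta> where \<delta>: "\<delta> > 0" "\<And>t. \<lbrakk>t > 0; t < \<delta>\<rbrakk> \<Longrightarrow> F t < 0"
    using F_if_small by blast
  have "\<exists>k>0. \<forall>x\<in>X. \<forall>y\<in>X. d x y < \<delta> \<longrightarrow> d ((T ^^ k) x) ((T ^^ k) y) < \<epsilon>"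
    if "\<epsilon> > 0" for \<epsilon>
  proof -
    obtain M where M: "\<And>t. \<lbrakk>t > 0; F t < M\<rbrakk> \<Longrightarrow> t < \<epsilon>"
      using small_if_F[OF \<open>\<epsilon> > 0\<close>] by blast
    have "\<forall>\<^sub>F n in sequentially. (\<psi> ^^ n) 0 < M \<and> n > 0"
      using funpow_\<psi> by (intro eventually_conj eventually_gt_at_top)
        (simp add: filterlim_at_bot_dense)
    \<comment> \<open>The induction in \<open>orbit_trapped\<close> goes back by k indices, hence
      \<open>k > 0\<close>.\<close>
    then obtain k where k: "(\<psi> ^^ k) 0 < M" "k > 0"
      by (auto simp: eventually_sequentially)
    have "d ((T ^^ k) x) ((T ^^ k) y) < \<epsilon>" if xy: "x \<in> X" "y \<in> X" "d x y < \<delta>" for x y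
    proof (cases "(T ^^ k) x = (T ^^ k) y")
      case True
      then show ?thesis
        using \<open>\<epsilon> > 0\<close> xy orbit_in dist_self by simp
    next
      case False
      then have "x \<noteq> y"
        by auto
      have "F (d ((T ^^ k) x) ((T ^^ k) y)) \<le> (\<psi> ^^ k) (F (d x y))"
        by (rule contraction_iter[OF xy(1,2) False])
      also have "\<dots> \<le> (\<psi> ^^ k) 0"
        using \<delta>(2)[OF dist_pos[OF xy(1,2) \<open>x \<noteq> y\<close>] xy(3)]
        by (intro funpow_mono[OF mono_\<psi>]) simp
      finally show ?thesis
        using k(1) False xy orbit_in by (intro M dist_pos) auto
    qed
    with k(2) show ?thesis
      by blast
  qed
  with \<delta>(1) show ?thesis
    by blast
qed

lemma orbit_trapped:
  assumes "x \<in> X" "\<epsilon> > 0"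
  shows "\<exists>N. \<forall>n\<ge>N. d ((T ^^ n) x) ((T ^^ N) x) < \<epsilon>"
proof -
  let ?u = "\<lambda>n. (T ^^ n) x"
  have u: "?u n \<in> X" for n
    using orbit_in assms(1) .
  have s: "s > 0"
    using const_ge_1 by simp
  obtain \<delta> where "\<delta> > 0" and
    shrink: "\<And>e. e > 0 \<Longrightarrow>
      \<exists>k>0. \<forall>x\<in>X. \<forall>y\<in>X. d x y < \<delta> \<longrightarrow> d ((T ^^ k) x) ((T ^^ k) y) < e"
    using uniform_shrinking by blast
  \<comment> \<open>At most \<epsilon> for the conclusion, at most \<delta> so that
    \<open>T ^^ k\<close> shrinks the whole e-ball.\<close>
  define e where "e = min \<epsilon> \<delta>"
  have e: "e > 0" "e \<le> \<epsilon>" "e \<le> \<delta>" "e / (2 * s) > 0"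
    using assms(2) \<open>\<delta> > 0\<close> s by (auto simp: e_def)
  obtain k where "k > 0" and
    k: "\<And>x y. \<lbrakk>x \<in> X; y \<in> X; d x y < \<delta>\<rbrakk> \<Longrightarrow> d ((T ^^ k) x) ((T ^^ k) y) < e / (2 * s)"
    using shrink[OF e(4)] by blast
  have "(\<lambda>n. d (?u n) (?u (i + n))) \<longlonglongrightarrow> 0" for i
    using dist_iter_tendsto_0[OF assms(1) u[of i]]
    by (simp flip: funpow_add[THEN fun_cong, unfolded comp_apply] add: add.commute)
  then have "\<forall>\<^sub>F n in sequentially. d (?u n) (?u (i + n)) < e / (2 * s)" for i
    using e(4) order_tendstoD(2) by blast
  then have "\<forall>\<^sub>F n in sequentially. \<forall>i\<in>{..k}. d (?u n) (?u (i + n)) < e / (2 * s)"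
    by (intro eventually_ball_finite) auto
  \<comment> \<open>Only finitely many i are involved, so one N serves them all. The indices up to k
    start the induction below; i = k also bounds how far \<open>T ^^ k\<close> moves the
    center.\<close>
  then obtain N where N: "\<And>i. i \<le> k \<Longrightarrow> d (?u N) (?u (i + N)) < e / (2 * s)"
    by (auto simp: eventually_sequentially)
  have "e / (2 * s) \<le> e"
    using e(1) const_ge_1 by (simp add: field_simps)
  have trapped: "d (?u (i + N)) (?u N) < e" for i
  proof (induction i rule: less_induct)
    case (less i)
    show ?case
    proof (cases "i \<le> k")
      case True
      then show ?thesis
        using N[OF True] \<open>e / (2 * s) \<le> e\<close> commute[OF u u] by (metis less_le_trans)
    next
      case False
      \<comment> \<open>The point is the image under \<open>T ^^ k\<close> of an earlier one, which
        lies in the ball by induction. The triangle inequality through the image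
        \<open>?u (k + N)\<close> of the center gives
        \<open>s * (e / (2 * s) + e / (2 * s)) = e\<close>.\<close>
      have split: "?u (i + N) = (T ^^ k) (?u (i - k + N))"
        using False by (simp flip: funpow_add[THEN fun_cong, unfolded comp_apply])
      have "d (?u (i - k + N)) (?u N) < e"
        using less.IH[of "i - k"] False \<open>k > 0\<close> by simp
      then have "d (?u (i + N)) (?u (k + N)) < e / (2 * s)"
        using k[OF u u, of "i - k + N" N] e(3) unfolding split by (simp add: funpow_add)
      moreover have "d (?u (k + N)) (?u N) < e / (2 * s)"
        using N[of k] commute[OF u u] by simp
      ultimately have "d (?u (i + N)) (?u (k + N)) + d (?u (k + N)) (?u N) < e / s"
        by (simp add: field_simps)
      then have "s * (d (?u (i + N)) (?u (k + N)) + d (?u (k + N)) (?u N)) < e"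
        using s by (simp add: field_simps)
      with triangle[OF u u u, of "i + N" N "k + N"] show ?thesis
        by linarith
    qed
  qed
  have "d (?u n) (?u N) < \<epsilon>" if "n \<ge> N" for n
    using trapped[of "n - N"] that e(2) by simp
  then show ?thesis
    by blast
qed

text \<open>Two points of the tail are compared through the center of a trapping ball; the radius
  \<open>\<epsilon> / (2 * s)\<close> absorbs the factor s.\<close>

lemma orbit_Cauchy:
  assumes "x \<in> X"
  shows "b_Cauchy d (\<lambda>n. (T ^^ n) x)"
  unfolding b_Cauchy_def
proof (intro allI impI)
  fix \<epsilon> :: real
  assume "\<epsilon> > 0"
  have s: "s > 0"
    using const_ge_1 by simp
  with \<open>\<epsilon> > 0\<close> obtain N where N: "\<And>n. n \<ge> N \<Longrightarrow> d ((T ^^ n) x) ((T ^^ N) x) < \<epsilon> / (2 * s)"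
    using orbit_trapped[OF assms, of "\<epsilon> / (2 * s)"] by auto
  have "d ((T ^^ m) x) ((T ^^ n) x) < \<epsilon>" if "m \<ge> N" "n \<ge> N" for m n
  proof -
    have "d ((T ^^ m) x) ((T ^^ N) x) + d ((T ^^ N) x) ((T ^^ n) x) < \<epsilon> / s"
      using N[OF that(1)] N[OF that(2)] commute[OF orbit_in orbit_in, of x x n N] assms
      by (simp add: field_simps)
    then have "s * (d ((T ^^ m) x) ((T ^^ N) x) + d ((T ^^ N) x) ((T ^^ n) x)) < \<epsilon>"
      using s by (simp add: field_simps)
    then show ?thesis
      using triangle[OF orbit_in orbit_in orbit_in, of x x x m n N] assms by simp
  qed
  then show "\<exists>N. \<forall>m\<ge>N. \<forall>n\<ge>N. d ((T ^^ m) x) ((T ^^ n) x) < \<epsilon>"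
    by blast
qed

text \<open>As d need not be continuous, no limit is taken inside d. Instead the triangle inequality
  through \<open>?u (Suc n)\<close> bounds the constant \<open>d p (T p)\<close> by a null
  sequence.\<close>

lemma orbit_limit_fixed:
  assumes "x \<in> X" "p \<in> X" "b_converges d (\<lambda>n. (T ^^ n) x) p"
  shows "T p = p"
proof -
  let ?u = "\<lambda>n. (T ^^ n) x"
  have u: "?u n \<in> X" for n
    using orbit_in assms(1) .
  have lim: "(\<lambda>n. d (?u n) p) \<longlonglongrightarrow> 0"
    using assms(3) by (simp add: b_converges_def)
  have lim_T: "(\<lambda>n. d (?u (Suc n)) (T p)) \<longlonglongrightarrow> 0"
  proof (rule order_tendstoI)
    fix \<epsilon> :: real
    assume "0 < \<epsilon>"
    then obtain \<delta> where "\<delta> > 0"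
      and \<delta>: "\<And>x y. \<lbrakk>x \<in> X; y \<in> X; d x y < \<delta>\<rbrakk> \<Longrightarrow> d (T x) (T y) < \<epsilon>"
      using continuity by blast
    show "\<forall>\<^sub>F n in sequentially. d (?u (Suc n)) (T p) < \<epsilon>"
      using order_tendstoD(2)[OF lim \<open>\<delta> > 0\<close>]
      by eventually_elim (use \<delta> u assms(2) in auto)
  next
    fix a :: real
    assume "a < 0"
    then show "\<forall>\<^sub>F n in sequentially. a < d (?u (Suc n)) (T p)"
      using nonneg[OF u T_in[OF assms(2)]]
      by (intro always_eventually allI) (meson less_le_trans)
  qed
  have "(\<lambda>n. s * (d (?u (Suc n)) p + d (?u (Suc n)) (T p))) \<longlonglongrightarrow> s * (0 + 0)"
    by (intro tendsto_intros lim_T LIMSEQ_Suc[OF lim])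
  moreover have "d p (T p) \<le> s * (d (?u (Suc n)) p + d (?u (Suc n)) (T p))" for n
    using triangle[OF assms(2) T_in[OF assms(2)] u, of "Suc n"] commute[OF assms(2) u, of "Suc n"]
    by simp
  ultimately have "d p (T p) \<le> s * (0 + 0)"
    by (intro LIMSEQ_le_const) auto
  with dist_pos[OF assms(2) T_in[OF assms(2)]] show ?thesis
    by fastforce
qed

lemma picard_if_complete:
  assumes "b_complete X d" and "X \<noteq> {}"
  shows "picard_operator X d T"
proof -
  obtain x0 where "x0 \<in> X"
    using assms(2) by blast
  have "range (\<lambda>n. (T ^^ n) x0) \<subseteq> X"
    using orbit_in \<open>x0 \<in> X\<close> by blast
  then obtain p where p: "p \<in> X" "b_converges d (\<lambda>n. (T ^^ n) x0) p"
    using assms(1) orbit_Cauchy[OF \<open>x0 \<in> X\<close>] unfolding b_complete_def by blast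
  then have fixed: "T p = p"
    using orbit_limit_fixed[OF \<open>x0 \<in> X\<close>] by blast
  have p_iter: "(T ^^ n) p = p" for n
    by (induction n) (simp_all add: fixed)
  \<comment> \<open>Any orbit approaches the orbit of p, which is constant.\<close>
  have "b_converges d (\<lambda>n. (T ^^ n) x) p" if "x \<in> X" for x
    using dist_iter_tendsto_0[OF that p(1)] by (simp add: b_converges_def p_iter)
  with p(1) fixed fixed_point_unique self_map show ?thesis
    unfolding picard_operator_def by blast
qed

end

end

section \<open>Reduction of the theorem to the two cases\<close>

theorem theorem3p2:
  fixes \<psi> F :: "real \<Rightarrow> real"
    and X :: "'a set" and d :: "'a \<Rightarrow> 'a \<Rightarrow> real" and s :: real
    and T :: "'a \<Rightarrow> 'a"
  assumes "mono \<psi>"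
    and "\<And>t. t > 0 \<Longrightarrow> filterlim (\<lambda>n. (\<psi> ^^ n) t) at_bot sequentially"
    and "bdd_below (F ` {0<..}) \<or>
         (\<forall>\<alpha> :: nat \<Rightarrow> real. (\<forall>n. \<alpha> n > 0) \<longrightarrow>
            (filterlim (\<lambda>n. F (\<alpha> n)) at_bot sequentially \<longleftrightarrow> \<alpha> \<longlonglongrightarrow> 0))"
    and "b_metric_space X d s"
    and "X \<noteq> {}"
    and "b_complete X d"
    and "T \<in> X \<rightarrow> X"
    and "\<And>x y. \<lbrakk>x \<in> X; y \<in> X; d (T x) (T y) \<noteq> 0\<rbrakk> \<Longrightarrow>
           F (d (T x) (T y)) \<le> \<psi> (F (d x y))"
  shows "picard_operator X d T"
proof -
  interpret b_metric_space X d s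
    by fact
  interpret F_contraction X d s \<psi> F T
    by unfold_locales (use assms funpow_at_bot_everywhere in blast)+
  from assms(3) show ?thesis
  proof
    assume "bdd_below (F ` {0<..})"
    then show ?thesis
      using picard_if_bdd_below assms(5) by blast
  next
    assume *: "\<forall>\<alpha> :: nat \<Rightarrow> real. (\<forall>n. \<alpha> n > 0) \<longrightarrow>
            (filterlim (\<lambda>n. F (\<alpha> n)) at_bot sequentially \<longleftrightarrow> \<alpha> \<longlonglongrightarrow> 0)"
    show ?thesis
    proof (rule picard_if_complete)
      show "\<exists>M. \<forall>t>0. F t < M \<longrightarrow> t < \<epsilon>" if "\<epsilon> > 0" for \<epsilon>
        using * by (intro small_argument_if_at_bot that) blast
      show "\<exists>\<delta>>0. \<forall>t>0. t < \<delta> \<longrightarrow> F t < M" for M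
        using * by (intro at_bot_if_small_argument) blast
    qed fact+
  qed
qed

end
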